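(* Let $X_V$, $\underline{\underline{M}}$, $\underline{\underline{D}}$, $\underline{\underline{R}}$, $\underline{\underline{B}}$ and the multiplication operators $\underline{\underline{u}}$ be the data of a general summation-by-parts (SBP) method on the reference element $[-1,1]$ as described in the context; in particular $\underline{\underline{M}}$ is an arbitrary (not necessarily diagonal) symmetric positive definite matrix, the basis may be nodal or modal, no boundary nodes are required, and $$\underline{\underline{M}}\,\underline{\underline{D}}+\underline{\underline{D}}^T\underline{\underline{M}}=\underline{\underline{R}}^T\underline{\underline{B}}\,\underline{\underline{R}}.$$ Let $f^{\mathrm{num}}:\mathbb{R}^2\to\mathbb{R}$ be a numerical flux satisfying $$\frac16\left(u_-^3-u_+^3\right)-(u_--u_+)\,f^{\mathrm{num}}(u_-,u_+)\le 0\qquad\text{for all }u_-,u_+\in\mathbb{R}.\tag{$*$}$$ Consider the semidiscretisation of the inviscid Burgers' equation $\partial_t u+\partial_x\frac{u^2}{2}=0$ with periodic boundary conditions which, after mapping each element to $[-1,1]$, reads on each element $$\partial_t\underline{u}+\underline{\underline{D}}\,\tfrac12\underline{u^2}+\underline{c}_{\mathrm{div}}+\underline{\underline{C}}\left(\underline{f}^{\mathrm{num}}-\underline{\underline{R}}\,\tfrac12\underline{u^2}-\underline{c}_{\mathrm{res}}\right)=\underline{0},\qquad \underline{\underline{C}}=\underline{\underline{M}}^{-1}\underline{\underline{R}}^T\underline{\underline{B}},$$ with correction terms $$\underline{c}_{\mathrm{div}}=\frac13\left(\underline{\underline{M}}^{-1}\underline{\underline{u}}^T\underline{\underline{M}}\,\underline{\underline{D}}\,\underline{u}-\frac12\underline{\underline{D}}\,\underline{\underline{u}}\,\underline{u}\right),\qquad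 \underline{c}_{\mathrm{res}}=\frac16\left((\underline{\underline{R}}\,\underline{u})^2-\underline{\underline{R}}\,\underline{\underline{u}}\,\underline{u}\right).$$ Then this method is both conservative across elements and stable across elements in the discrete norm $\|\cdot\|_M$ induced by $\underline{\underline{M}}$ (in the sense defined in the context). Moreover, the following numerical fluxes satisfy $( * )$: (1) the energy conservative (ECON) flux $f^{\mathrm{num}}(u_-,u_+)=\frac14(u_+^2+u_-^2)-\frac{(u_+-u_-)^2}{12}$; (2) the local Lax-Friedrichs (LLF) flux $f^{\mathrm{num}}(u_-,u_+)=\frac14(u_+^2+u_-^2)-\frac{\max(|u_+|,|u_-|)}{2}(u_+-u_-)$; (3) Osher's flux $$f^{\mathrm{num}}(u_-,u_+)=\begin{cases}\frac{u_-^2}{2},&u_+,u_->0,\\ \frac{u_+^2}{2},&u_+,u_-<0,\\ \frac{u_+^2}{2}+\frac{u_-^2}{2},&u_-\ge0\ge u_+,\\ 0,&u_-\le0\le u_+.\end{cases}$$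
   Context: Reference-element data. $X_V$ is a finite-dimensional real vector space of polynomials on $[-1,1]$ containing all polynomials of degree $\le p$ for some $p\ge1$, with a fixed basis. For $v\in X_V$, $\underline{v}$ denotes its coefficient vector in this basis, and $\underline{1}$ is the coefficient vector of the constant function $1$. Double underlines denote matrices with respect to this basis. - $\underline{\underline{M}}$ is a real symmetric positive definite matrix, defining the scalar product $\langle\underline{u},\underline{v}\rangle_M=\underline{u}^T\underline{\underline{M}}\,\underline{v}$ (an approximation of the $L^2$ scalar product) and the norm $\|u\|_M^2=\underline{u}^T\underline{\underline{M}}\,\underline{u}$. - $\underline{\underline{D}}$ represents a linear derivative operator $X_V\to X_V$ that is exact for constants: $\underline{\underline{D}}\,\underline{1}=\underline{0}$. - $\underline{\underline{R}}$ represents the restriction to the boundary, $\underline{\underline{R}}\,\underline{v}=(v(-1),v(1))^T\in\mathbb{R}^2$; write $(u_L,u_R)^T=\underline{\underline{R}}\,\underline{u}$. - $\underline{\underline{B}}=\operatorname{diag}(-1,1)$. Multiplication. Fix a vector space $X_V^+\supset X_V$ of polynomials containing all products of two elements of $X_V$, and a linear projection $P:X_V^+\to X_V$ (so $Pw=w$ for $w\in X_V$), e.g. interpolation at the nodes for a nodal basis or $L^2$-orthogonal projection for a modal Legendre basis. For $u\in X_V$, the matrix $\underline{\underline{u}}$ represents $v\mapsto P(uv)$ on $X_V$. In particular $\underline{\underline{u}}\,\underline{1}=\underline{u}$. The notation $\underline{u^2}$ means $\underline{\underline{u}}\,\underline{u}$. The matrix $\underline{\underline{u}}^T$ is the transpose,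 and $\underline{\underline{M}}^{-1}\underline{\underline{u}}^T\underline{\underline{M}}$ is the adjoint of $\underline{\underline{u}}$ with respect to $\langle\cdot,\cdot\rangle_M$. The square $(\underline{\underline{R}}\,\underline{u})^2=(u_L^2,u_R^2)^T$ is taken componentwise. Coupling of elements. The periodic spatial domain is divided into finitely many non-overlapping intervals (elements), cyclically ordered, each mapped affinely to $[-1,1]$. The solution on each element is represented by its own time-dependent coefficient vector $\underline{u}(t)$. On each element $\underline{f}^{\mathrm{num}}=(f^{\mathrm{num}}_L,f^{\mathrm{num}}_R)^T$ contains the numerical fluxes at its left and right boundary. At every boundary point between two neighbouring elements the common value is $f^{\mathrm{num}}(u_-,u_+)$, where $u_-$ is the boundary value (a component of $\underline{\underline{R}}\,\underline{u}$) from the element to the left of that point and $u_+$ the one from the element to the right; this same value is used by both elements. The element equation is written in reference coordinates. For an element of physical width $\Delta x$, the constant Jacobian factor $\Delta x/2$ of the affine mapping multiplies $\partial_t\underline{u}$ and correspondingly weights that element's contribution to the global sums below. Conservative across elements: along every differentiable-in-time solution of the semidiscrete system, $\frac{\mathrm{d}}{\mathrm{d}t}\sum \underline{1}^T\underline{\underline{M}}\,\underline{u}=0$, the sum being over all elements (each weighted by its Jacobian factor). Stable across elements in $\|\cdot\|_M$: along every such solution, $\frac{\mathrm{d}}{\mathrm{d}t}\sum\|u\|_M^2\le0$, the sum being over all elements (each weighted by its Jacobian factor). *)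

theory Defs
  imports "HOL-Analysis.Analysis" "HOL-Computational_Algebra.Polynomial"
begin

interpretation poly_vs: vector_space "smult :: real \<Rightarrow> real poly \<Rightarrow> real poly"
  by unfold_locales (simp_all add: smult_add_right smult_add_left)

(* A basis of the polynomial space is an injective family indexed by the finite type 'n.
   Since [-1,1] is infinite, a polynomial function on [-1,1] determines its polynomial,
   so the elements of the space are taken in "real poly". *)

definition coeff_vec :: "('n::finite \<Rightarrow> real poly) \<Rightarrow> real poly \<Rightarrow> real^'n" where
  "coeff_vec \<phi> v = (\<chi> j. poly_vs.representation (range \<phi>) v (\<phi> j))"

definition poly_of_vec :: "('n::finite \<Rightarrow> real poly) \<Rightarrow> real^'n \<Rightarrow> real poly" where
  "poly_of_vec \<phi> c = (\<Sum>j\<in>UNIV. smult (c $ j) (\<phi> j))"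

abbreviation one_vec :: "('n::finite \<Rightarrow> real poly) \<Rightarrow> real^'n" where
  "one_vec \<phi> \<equiv> coeff_vec \<phi> 1"

definition restriction_mat :: "('n::finite \<Rightarrow> real poly) \<Rightarrow> real^'n^2" where
  "restriction_mat \<phi> = matrix (\<lambda>c. vector [poly (poly_of_vec \<phi> c) (-1), poly (poly_of_vec \<phi> c) 1])"

definition boundary_mat :: "real^2^2" where
  "boundary_mat = vector [vector [-1, 0], vector [0, 1]]"

definition mult_mat ::
    "('n::finite \<Rightarrow> real poly) \<Rightarrow> (real poly \<Rightarrow> real poly) \<Rightarrow> real^'n \<Rightarrow> real^'n^'n" where
  "mult_mat \<phi> P u = matrix (\<lambda>c. coeff_vec \<phi> (P (poly_of_vec \<phi> u * poly_of_vec \<phi> c)))"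

definition inner_mat :: "real^'n^'n \<Rightarrow> real^'n::finite \<Rightarrow> real^'n \<Rightarrow> real" where
  "inner_mat M u v = u \<bullet> (M *v v)"

definition norm_mat :: "real^'n^'n \<Rightarrow> real^'n::finite \<Rightarrow> real" where
  "norm_mat M u = sqrt (inner_mat M u u)"

(* P is a total function on polynomials, but only its values on Xp are meaningful. *)
locale sbp_method =
  fixes X Xp :: "real poly set"
    and \<phi> :: "'n::finite \<Rightarrow> real poly"
    and P :: "real poly \<Rightarrow> real poly"
    and M D :: "real^'n^'n"
  assumes inj_basis: "inj \<phi>"
    and independent_basis: "poly_vs.independent (range \<phi>)"
    and span_basis: "poly_vs.span (range \<phi>) = X"
    and contains_polys: "\<exists>p\<ge>1. \<forall>q. degree q \<le> p \<longrightarrow> q \<in> X"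
    and subspace_Xp: "poly_vs.subspace Xp"
    and X_subset_Xp: "X \<subseteq> Xp"
    and products_in_Xp: "\<And>v w. v \<in> X \<Longrightarrow> w \<in> X \<Longrightarrow> v * w \<in> Xp"
    and P_maps_to: "\<And>w. w \<in> Xp \<Longrightarrow> P w \<in> X"
    and P_add: "\<And>v w. v \<in> Xp \<Longrightarrow> w \<in> Xp \<Longrightarrow> P (v + w) = P v + P w"
    and P_smult: "\<And>a w. w \<in> Xp \<Longrightarrow> P (smult a w) = smult a (P w)"
    and P_id: "\<And>w. w \<in> X \<Longrightarrow> P w = w"
    and M_sym: "transpose M = M"
    and M_pos: "\<And>v. v \<noteq> 0 \<Longrightarrow> 0 < inner_mat M v v"
    and D_one: "D *v one_vec \<phi> = 0"
    and sbp: "M ** D + transpose D ** M =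
      transpose (restriction_mat \<phi>) ** boundary_mat ** restriction_mat \<phi>"

definition c_div ::
    "('n::finite \<Rightarrow> real poly) \<Rightarrow> (real poly \<Rightarrow> real poly) \<Rightarrow> real^'n^'n \<Rightarrow> real^'n^'n \<Rightarrow> real^'n \<Rightarrow> real^'n" where
  "c_div \<phi> P M D u = (1/3) *\<^sub>R
     ((matrix_inv M ** transpose (mult_mat \<phi> P u) ** M ** D) *v u
      - (1/2) *\<^sub>R (D *v (mult_mat \<phi> P u *v u)))"

definition c_res ::
    "('n::finite \<Rightarrow> real poly) \<Rightarrow> (real poly \<Rightarrow> real poly) \<Rightarrow> real^'n \<Rightarrow> real^2" where
  "c_res \<phi> P u = (1/6) *\<^sub>R
     ((\<chi> k. ((restriction_mat \<phi> *v u) $ k)\<^sup>2) - restriction_mat \<phi> *v (mult_mat \<phi> P u *v u))"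

(* Everything in the element equation (in reference coordinates) except the time derivative;
   fn holds the numerical fluxes at the left and right boundary of the element. *)
definition burgers_element ::
    "('n::finite \<Rightarrow> real poly) \<Rightarrow> (real poly \<Rightarrow> real poly) \<Rightarrow> real^'n^'n \<Rightarrow> real^'n^'n \<Rightarrow> real^2 \<Rightarrow> real^'n \<Rightarrow> real^'n" where
  "burgers_element \<phi> P M D fn u =
     (let R = restriction_mat \<phi>;
          C = matrix_inv M ** transpose R ** boundary_mat;
          u2 = mult_mat \<phi> P u *v u
      in D *v ((1/2) *\<^sub>R u2) + c_div \<phi> P M D u
         + C *v (fn - R *v ((1/2) *\<^sub>R u2) - c_res \<phi> P u))"

(* N elements; element i < N is the interval from x i to x (Suc i), and the point x N is
   identified with x 0. *)
definition periodic_mesh :: "nat \<Rightarrow> (nat \<Rightarrow> real) \<Rightarrow> bool" where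
  "periodic_mesh N x \<longleftrightarrow> 0 < N \<and> (\<forall>i<N. x i < x (Suc i))"

definition jacobian :: "(nat \<Rightarrow> real) \<Rightarrow> nat \<Rightarrow> real" where
  "jacobian x i = (x (Suc i) - x i) / 2"

definition right_neighbour :: "nat \<Rightarrow> nat \<Rightarrow> nat" where
  "right_neighbour N i = (i + 1) mod N"

definition left_neighbour :: "nat \<Rightarrow> nat \<Rightarrow> nat" where
  "left_neighbour N i = (i + N - 1) mod N"

(* The flux at the right boundary point of element i: components 1 and 2 of the
   restriction are the values at the left and right end of an element. *)
definition interface_flux ::
    "('n::finite \<Rightarrow> real poly) \<Rightarrow> (real \<Rightarrow> real \<Rightarrow> real) \<Rightarrow> nat \<Rightarrow> (nat \<Rightarrow> real^'n) \<Rightarrow> nat \<Rightarrow> real" where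
  "interface_flux \<phi> fnum N u i =
     fnum ((restriction_mat \<phi> *v u i) $ 2) ((restriction_mat \<phi> *v u (right_neighbour N i)) $ 1)"

definition flux_vec ::
    "('n::finite \<Rightarrow> real poly) \<Rightarrow> (real \<Rightarrow> real \<Rightarrow> real) \<Rightarrow> nat \<Rightarrow> (nat \<Rightarrow> real^'n) \<Rightarrow> nat \<Rightarrow> real^2" where
  "flux_vec \<phi> fnum N u i =
     vector [interface_flux \<phi> fnum N u (left_neighbour N i), interface_flux \<phi> fnum N u i]"

(* Solutions live on a nondegenerate time interval T; derivatives at an endpoint
   belonging to T are one-sided. *)
definition burgers_solution ::
    "('n::finite \<Rightarrow> real poly) \<Rightarrow> (real poly \<Rightarrow> real poly) \<Rightarrow> real^'n^'n \<Rightarrow> real^'n^'n \<Rightarrow>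
     (real \<Rightarrow> real \<Rightarrow> real) \<Rightarrow> nat \<Rightarrow> (nat \<Rightarrow> real) \<Rightarrow> real set \<Rightarrow> (nat \<Rightarrow> real \<Rightarrow> real^'n) \<Rightarrow> bool" where
  "burgers_solution \<phi> P M D fnum N x T u \<longleftrightarrow>
     is_interval T \<and> interior T \<noteq> {} \<and>
     (\<forall>t\<in>T. \<forall>i<N. \<exists>u'. (u i has_vector_derivative u') (at t within T) \<and>
        jacobian x i *\<^sub>R u'
          + burgers_element \<phi> P M D (flux_vec \<phi> fnum N (\<lambda>k. u k t) i) (u i t) = 0)"

(* In the next two definitions, sol is the solution predicate of a semidiscrete system. *)

definition conservative_across_elements ::
    "('n::finite \<Rightarrow> real poly) \<Rightarrow> real^'n^'n \<Rightarrow> nat \<Rightarrow> (nat \<Rightarrow> real) \<Rightarrow>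
     (real set \<Rightarrow> (nat \<Rightarrow> real \<Rightarrow> real^'n) \<Rightarrow> bool) \<Rightarrow> bool" where
  "conservative_across_elements \<phi> M N x sol \<longleftrightarrow>
     (\<forall>T u. sol T u \<longrightarrow> (\<forall>t\<in>T.
        ((\<lambda>s. \<Sum>i<N. jacobian x i * inner_mat M (one_vec \<phi>) (u i s))
          has_real_derivative 0) (at t within T)))"

definition stable_across_elements ::
    "real^'n::finite^'n \<Rightarrow> nat \<Rightarrow> (nat \<Rightarrow> real) \<Rightarrow>
     (real set \<Rightarrow> (nat \<Rightarrow> real \<Rightarrow> real^'n) \<Rightarrow> bool) \<Rightarrow> bool" where
  "stable_across_elements M N x sol \<longleftrightarrow>
     (\<forall>T u. sol T u \<longrightarrow> (\<forall>t\<in>T. \<exists>d\<le>0.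
        ((\<lambda>s. \<Sum>i<N. jacobian x i * (norm_mat M (u i s))\<^sup>2)
          has_real_derivative d) (at t within T)))"

definition entropy_stable_flux :: "(real \<Rightarrow> real \<Rightarrow> real) \<Rightarrow> bool" where
  "entropy_stable_flux fnum \<longleftrightarrow>
     (\<forall>um up. (1/6) * (um^3 - up^3) - (um - up) * fnum um up \<le> 0)"

definition econ_flux :: "real \<Rightarrow> real \<Rightarrow> real" where
  "econ_flux um up = (1/4) * (up\<^sup>2 + um\<^sup>2) - (up - um)\<^sup>2 / 12"

definition llf_flux :: "real \<Rightarrow> real \<Rightarrow> real" where
  "llf_flux um up = (1/4) * (up\<^sup>2 + um\<^sup>2) - max \<bar>up\<bar> \<bar>um\<bar> / 2 * (up - um)"

(* The last branch is the case um \<le> 0 \<le> up; it overlaps the third one only at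
   um = up = 0, where both give 0. *)
definition osher_flux :: "real \<Rightarrow> real \<Rightarrow> real" where
  "osher_flux um up =
     (if up > 0 \<and> um > 0 then um\<^sup>2 / 2
      else if up < 0 \<and> um < 0 then up\<^sup>2 / 2
      else if um \<ge> 0 \<and> 0 \<ge> up then up\<^sup>2 / 2 + um\<^sup>2 / 2
      else 0)"

end

theory Submission
  imports Defs
begin

text \<open>
  Both global balances come from testing the element equation against a vector \<open>a\<close> in the
  discrete scalar product. Because \<open>M\<^sup>-\<^sup>1 U\<^sup>T M\<close> is the adjoint of multiplication by \<open>u\<close>, the
  element terms reduce (lemma \<open>element_weak_form\<close>) to
  \<open>(\<langle>a, D u\<^sup>2\<rangle> + \<langle>U a, D u\<rangle>) / 3\<close> plus boundary terms: this is the split form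
  \<open>(\<partial>\<^sub>x u\<^sup>2 + u \<partial>\<^sub>x u) / 3\<close> of Burgers' equation, with the multiplication by \<open>u\<close> moved onto the
  test vector. The discrete derivative obeys no product rule, but for this form summation by
  parts suffices.

  For \<open>a = u\<close> one has \<open>U a = u\<^sup>2\<close>, and the two volume terms together are exactly one application
  of summation by parts. For \<open>a = 1\<close> one has \<open>U a = u\<close>; the first term is a boundary term because
  \<open>D 1 = 0\<close>, the second because \<open>\<langle>u, D u\<rangle>\<close> is half a boundary term. In both cases the part
  of the boundary terms that contains the restriction of \<open>u\<^sup>2\<close> cancels, also when restricting and
  multiplying do not commute; this is what the correction \<open>c_res\<close> is for. What is left depends
  only on the boundary values \<open>u\<^sub>L\<close>, \<open>u\<^sub>R\<close> and the numerical fluxes: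
  \<open>f\<^sub>R - f\<^sub>L\<close> for \<open>a = 1\<close> and \<open>(u\<^sub>R f\<^sub>R - u\<^sub>R\<^sup>3/6) - (u\<^sub>L f\<^sub>L - u\<^sub>L\<^sup>3/6)\<close> for \<open>a = u\<close>.

  Summed over the periodic mesh and regrouped by interfaces, the first cancels, and the
  negative of the second, which drives half the discrete energy, becomes at each interface the
  left-hand side of the flux condition. That left-hand side equals
  \<open>(u\<^sub>- - u\<^sub>+) (f\<^sub>E - f)\<close>, where \<open>f\<^sub>E\<close> is the energy conservative flux (lemma
  \<open>entropy_production_econ\<close>), so a flux is admissible iff it is at least as dissipative
  as \<open>f\<^sub>E\<close>; the three fluxes are compared with \<open>f\<^sub>E\<close>.
\<close>

section \<open>Numerical fluxes\<close>

lemma econ_flux_eq: "econ_flux um up = (um\<^sup>2 + um * up + up\<^sup>2) / 6"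
  by (simp add: econ_flux_def power2_eq_square field_simps)

text \<open>
  The potential difference \<open>(u\<^sub>-\<^sup>3 - u\<^sub>+\<^sup>3)/6\<close> is \<open>u\<^sub>- - u\<^sub>+\<close> times the energy conservative flux.
\<close>

lemma entropy_production_econ:
  "(1/6) * (um^3 - up^3) - (um - up) * f = (um - up) * (econ_flux um up - f)"
  by (simp add: econ_flux_eq power2_eq_square power3_eq_cube field_simps)

lemma entropy_stable_flux_iff:
  "entropy_stable_flux fnum \<longleftrightarrow> (\<forall>um up. (um - up) * (econ_flux um up - fnum um up) \<le> 0)"
  unfolding entropy_stable_flux_def entropy_production_econ ..

lemma entropy_stable_econ_flux: "entropy_stable_flux econ_flux"
  by (simp add: entropy_stable_flux_iff)

text \<open>
  With \<open>m\<close> the larger of the two wave speeds, the flux adds to the central flux the dissipation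
  \<open>m/2\<close> times the jump. A jump never exceeds \<open>2 m\<close> in modulus, so this outweighs the quadratic
  difference \<open>(u\<^sub>+ - u\<^sub>-)\<^sup>2/12\<close> of the central and the energy conservative flux.
\<close>

lemma entropy_stable_llf_flux: "entropy_stable_flux llf_flux"
  unfolding entropy_stable_flux_iff
proof (intro allI)
  fix um up :: real
  define m where "m = max \<bar>up\<bar> \<bar>um\<bar>"
  have "(um - up) * (econ_flux um up - llf_flux um up)
      = - ((um - up)\<^sup>2 * ((um - up) + 6 * m)) / 12"
    by (simp add: econ_flux_def llf_flux_def m_def[symmetric] power2_eq_square field_simps)
  moreover have "0 \<le> (um - up) + 6 * m"
    unfolding m_def by (auto simp: max_def abs_if split: if_splits)
  ultimately show "(um - up) * (econ_flux um up - llf_flux um up) \<le> 0"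
    by simp
qed

lemma entropy_stable_osher_flux: "entropy_stable_flux osher_flux"
  unfolding entropy_stable_flux_iff
proof (intro allI)
  fix um up :: real
  consider "up > 0" "um > 0" | "up < 0" "um < 0" | "um \<ge> 0" "up \<le> 0" | "um \<le> 0" "up \<ge> 0"
    by linarith
  then show "(um - up) * (econ_flux um up - osher_flux um up) \<le> 0"
  proof cases
    case 1
    \<comment> \<open>The difference of the fluxes vanishes at equal states, so a second factor splits off.\<close>
    then have "(um - up) * (econ_flux um up - osher_flux um up)
        = - ((um - up)\<^sup>2 * (up + 2 * um)) / 6"
      by (simp add: econ_flux_eq osher_flux_def power2_eq_square field_simps)
    with 1 show ?thesis by simp
  next
    case 2
    then have "(um - up) * (econ_flux um up - osher_flux um up)
        = - ((um - up)\<^sup>2 * (- um - 2 * up)) / 6"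
      by (simp add: econ_flux_eq osher_flux_def power2_eq_square field_simps)
    with 2 show ?thesis by simp
  next
    case 3
    then have "econ_flux um up - osher_flux um up = (um * up - 2 * um\<^sup>2 - 2 * up\<^sup>2) / 6"
      by (simp add: econ_flux_eq osher_flux_def field_simps)
    moreover have "um * up \<le> 0" using 3 by (simp add: mult_nonneg_nonpos)
    then have "um * up - 2 * um\<^sup>2 - 2 * up\<^sup>2 \<le> 0"
      using zero_le_power2[of um] zero_le_power2[of up] by linarith
    ultimately have "econ_flux um up - osher_flux um up \<le> 0" by simp
    with 3 show ?thesis by (simp add: mult_nonneg_nonpos)
  next
    case 4
    then have "osher_flux um up = 0"
      by (auto simp: osher_flux_def)
    \<comment> \<open>The energy conservative flux is a positive semidefinite quadratic form.\<close>
    moreover have "0 \<le> econ_flux um up"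
    proof -
      have "econ_flux um up = ((um + up)\<^sup>2 + um\<^sup>2 + up\<^sup>2) / 12"
        by (simp add: econ_flux_eq power2_eq_square field_simps)
      also have "\<dots> \<ge> 0" by (intro divide_nonneg_nonneg add_nonneg_nonneg) auto
      finally show ?thesis .
    qed
    ultimately show ?thesis using 4 by (simp add: mult_nonpos_nonneg)
  qed
qed

section \<open>Matrices, coefficient vectors and boundary values\<close>

lemma inner_vector_matrix_mult: "a \<bullet> (b v* A) = (A *v a) \<bullet> (b :: real^'m::finite)"
  for A :: "real^'n::finite^'m"
  by (metis dot_lmul_matrix inner_commute)

lemma inner_boundary_mat: "a \<bullet> (boundary_mat *v y) = a $ 2 * y $ 2 - a $ 1 * y $ 1"
  by (simp add: boundary_mat_def matrix_vector_mult_def inner_vec_def sum_2)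

lemma linear_poly_of_vec_eval: "linear (\<lambda>c. poly (poly_of_vec \<phi> c) z)"
  by (rule linearI)
     (simp_all add: poly_of_vec_def poly_sum sum.distrib distrib_right sum_distrib_left mult.assoc)

lemma restriction_mat_mult:
  "restriction_mat \<phi> *v c = vector [poly (poly_of_vec \<phi> c) (-1), poly (poly_of_vec \<phi> c) 1]"
proof -
  have "linear (\<lambda>c. vector [poly (poly_of_vec \<phi> c) (-1), poly (poly_of_vec \<phi> c) 1] :: real^2)"
    by (rule linearI)
       (simp_all add: vec_eq_iff forall_2 linear_add[OF linear_poly_of_vec_eval]
         linear_cmul[OF linear_poly_of_vec_eval])
  from fun_cong[OF matrix_vector_mul(2)[OF this]] show ?thesis
    unfolding restriction_mat_def .
qed

context sbp_method
begin

lemma poly_of_vec_coeff_vec: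
  assumes "v \<in> X" shows "poly_of_vec \<phi> (coeff_vec \<phi> v) = v"
proof -
  have "(\<Sum>b\<in>range \<phi>. smult (poly_vs.representation (range \<phi>) v b) b) = v"
    by (rule poly_vs.sum_representation_eq)
       (use independent_basis span_basis assms in auto)
  then show ?thesis
    by (simp add: poly_of_vec_def coeff_vec_def sum.reindex[OF inj_basis])
qed

lemma poly_of_vec_in_X: "poly_of_vec \<phi> c \<in> X"
  unfolding poly_of_vec_def span_basis[symmetric]
  by (intro poly_vs.span_sum poly_vs.span_scale poly_vs.span_base) simp

lemma poly_of_vec_add: "poly_of_vec \<phi> (a + b) = poly_of_vec \<phi> a + poly_of_vec \<phi> b"
  by (simp add: poly_of_vec_def smult_add_left sum.distrib)

lemma poly_of_vec_scale: "poly_of_vec \<phi> (r *\<^sub>R a) = smult r (poly_of_vec \<phi> a)"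
  by (simp add: poly_of_vec_def poly_vs.scale_sum_right)

lemma coeff_vec_add:
  "v \<in> X \<Longrightarrow> w \<in> X \<Longrightarrow> coeff_vec \<phi> (v + w) = coeff_vec \<phi> v + coeff_vec \<phi> w"
  using independent_basis span_basis
  by (simp add: coeff_vec_def vec_eq_iff poly_vs.representation_add)

lemma coeff_vec_scale: "v \<in> X \<Longrightarrow> coeff_vec \<phi> (smult r v) = r *\<^sub>R coeff_vec \<phi> v"
  using independent_basis span_basis
  by (simp add: coeff_vec_def vec_eq_iff poly_vs.representation_scale)

lemma coeff_vec_poly_of_vec: "coeff_vec \<phi> (poly_of_vec \<phi> c) = c"
proof -
  have "poly_vs.representation (range \<phi>) (poly_of_vec \<phi> c) (\<phi> j) = c $ j" for j
  proof -
    have "poly_vs.representation (range \<phi>) (poly_of_vec \<phi> c)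
        = (\<lambda>b. \<Sum>i\<in>UNIV. poly_vs.representation (range \<phi>) (smult (c $ i) (\<phi> i)) b)"
      unfolding poly_of_vec_def
      by (rule poly_vs.representation_sum[OF independent_basis])
         (auto intro: poly_vs.span_scale poly_vs.span_base)
    then have "poly_vs.representation (range \<phi>) (poly_of_vec \<phi> c) (\<phi> j)
        = (\<Sum>i\<in>UNIV. poly_vs.representation (range \<phi>) (smult (c $ i) (\<phi> i)) (\<phi> j))"
      by (rule fun_cong)
    also have "\<dots> = (\<Sum>i\<in>UNIV. if i = j then c $ i else 0)"
      by (intro sum.cong refl)
         (simp add: poly_vs.representation_scale[OF independent_basis] poly_vs.span_base
           poly_vs.representation_basis[OF independent_basis] inj_eq[OF inj_basis] eq_commute)
    finally show ?thesis by simp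
  qed
  then show ?thesis by (simp add: coeff_vec_def vec_eq_iff)
qed

lemma one_in_X: "1 \<in> X"
  using contains_polys by (metis degree_1 le0)

lemma restriction_one: "restriction_mat \<phi> *v one_vec \<phi> = vector [1, 1]"
  by (simp add: restriction_mat_mult poly_of_vec_coeff_vec[OF one_in_X])

lemma mult_mat_mult:
  "mult_mat \<phi> P u *v c = coeff_vec \<phi> (P (poly_of_vec \<phi> u * poly_of_vec \<phi> c))"
proof -
  have prod: "poly_of_vec \<phi> u * poly_of_vec \<phi> c \<in> Xp" for c
    by (intro products_in_Xp poly_of_vec_in_X)
  have "linear (\<lambda>c. coeff_vec \<phi> (P (poly_of_vec \<phi> u * poly_of_vec \<phi> c)))"
    by (rule linearI)
       (simp_all add: poly_of_vec_add poly_of_vec_scale distrib_left P_add P_smult prod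
         coeff_vec_add coeff_vec_scale P_maps_to)
  from fun_cong[OF matrix_vector_mul(2)[OF this]] show ?thesis
    unfolding mult_mat_def .
qed

lemma mult_mat_one: "mult_mat \<phi> P u *v one_vec \<phi> = u"
  by (simp add: mult_mat_mult poly_of_vec_coeff_vec[OF one_in_X] P_id poly_of_vec_in_X
      coeff_vec_poly_of_vec)

section \<open>The element equation in weak form\<close>

lemma inner_mat_commute: "inner_mat M a b = inner_mat M b a"
  unfolding inner_mat_def by (metis M_sym dot_lmul_matrix inner_commute transpose_matrix_vector)

lemma M_matrix_inv: "M *v (matrix_inv M *v y) = y"
proof -
  have "M *v v = 0 \<Longrightarrow> v = 0" for v
    using M_pos[of v] by (auto simp: inner_mat_def)
  then have "invertible M"
    by (simp add: invertible_left_inverse matrix_left_invertible_ker)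
  then have "M ** matrix_inv M = mat 1"
    unfolding matrix_inv_def invertible_def by (rule someI2_ex) simp
  then show ?thesis
    by (simp add: matrix_vector_mul_assoc)
qed

lemma inner_mat_matrix_inv: "inner_mat M a (matrix_inv M *v y) = a \<bullet> y"
  by (simp add: inner_mat_def M_matrix_inv)

lemma summation_by_parts:
  "inner_mat M a (D *v b) + inner_mat M (D *v a) b
   = (restriction_mat \<phi> *v a) \<bullet> (boundary_mat *v (restriction_mat \<phi> *v b))"
proof -
  have "a \<bullet> ((M ** D + transpose D ** M) *v b)
      = a \<bullet> ((transpose (restriction_mat \<phi>) ** boundary_mat ** restriction_mat \<phi>) *v b)"
    by (simp only: sbp)
  then show ?thesis
    by (simp add: inner_mat_def matrix_vector_mult_add_rdistrib inner_add_right
        matrix_vector_mul_assoc[symmetric] inner_vector_matrix_mult)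
qed

text \<open>
  The terms \<open>D u\<^sup>2/2\<close> and \<open>- D u\<^sup>2/6\<close> combine to weight \<open>1/3\<close>, and the restrictions of
  \<open>u\<^sup>2\<close> to weight \<open>-1/3\<close>; this match makes the restriction of \<open>u\<^sup>2\<close> drop out of both balances. With a general test vector, one computation serves both the mass and the energy balance.
\<close>

lemma element_weak_form:
  fixes a u :: "real^'n" and fn :: "real^2"
  defines "R \<equiv> restriction_mat \<phi>" and "U \<equiv> mult_mat \<phi> P u"
  shows "inner_mat M a (burgers_element \<phi> P M D fn u)
    = (inner_mat M a (D *v (U *v u)) + inner_mat M (U *v a) (D *v u)) / 3
      + (R *v a) \<bullet> (boundary_mat *v
          (fn - (1/3) *\<^sub>R (R *v (U *v u)) - (1/6) *\<^sub>R (\<chi> k. ((R *v u) $ k)\<^sup>2)))"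
proof -
  define s where "s = (\<chi> k. ((R *v u) $ k)\<^sup>2)"
  define y where "y = fn - (1/3) *\<^sub>R (R *v (U *v u)) - (1/6) *\<^sub>R s"
  have res: "fn - R *v ((1/2) *\<^sub>R (U *v u)) - c_res \<phi> P u = y"
    by (simp add: y_def s_def c_res_def R_def[symmetric] U_def[symmetric] vec_eq_iff
        matrix_vector_mult_scaleR field_simps)
  have "burgers_element \<phi> P M D fn u
      = (1/3) *\<^sub>R (D *v (U *v u)) + (1/3) *\<^sub>R (matrix_inv M *v (transpose U *v (M *v (D *v u))))
        + matrix_inv M *v (transpose R *v (boundary_mat *v y))"
    unfolding burgers_element_def Let_def R_def[symmetric] U_def[symmetric] res
    by (simp add: c_div_def U_def[symmetric] vec_eq_iff matrix_vector_mult_scaleR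
        matrix_vector_mul_assoc[symmetric] field_simps)
  then have "inner_mat M a (burgers_element \<phi> P M D fn u)
      = (1/3) * inner_mat M a (D *v (U *v u))
        + (1/3) * inner_mat M a (matrix_inv M *v (transpose U *v (M *v (D *v u))))
        + inner_mat M a (matrix_inv M *v (transpose R *v (boundary_mat *v y)))"
    by (simp add: inner_mat_def matrix_vector_right_distrib matrix_vector_mult_scaleR
        inner_add_right)
  then show ?thesis
    unfolding y_def[unfolded s_def, symmetric] inner_mat_matrix_inv
    by (simp add: inner_vector_matrix_mult inner_mat_def add_divide_distrib)
qed

lemma element_mass_balance:
  "inner_mat M (one_vec \<phi>) (burgers_element \<phi> P M D fn u) = fn $ 2 - fn $ 1"
proof -
  let ?R = "restriction_mat \<phi>" and ?u2 = "mult_mat \<phi> P u *v u"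
  have "inner_mat M (one_vec \<phi>) (D *v ?u2) = (?R *v ?u2) $ 2 - (?R *v ?u2) $ 1"
    using summation_by_parts[of "one_vec \<phi>" ?u2]
    by (simp add: D_one restriction_one inner_boundary_mat inner_mat_def)
  moreover have "2 * inner_mat M u (D *v u) = ((?R *v u) $ 2)\<^sup>2 - ((?R *v u) $ 1)\<^sup>2"
    using summation_by_parts[of u u]
    by (simp add: inner_mat_commute[of "D *v u" u] inner_boundary_mat power2_eq_square)
  ultimately show ?thesis
    by (simp add: element_weak_form mult_mat_one restriction_one inner_boundary_mat field_simps)
qed

lemma element_energy_balance:
  defines "R \<equiv> restriction_mat \<phi>"
  shows "inner_mat M u (burgers_element \<phi> P M D fn u)
    = ((R *v u) $ 2 * fn $ 2 - ((R *v u) $ 2)^3 / 6)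
      - ((R *v u) $ 1 * fn $ 1 - ((R *v u) $ 1)^3 / 6)"
proof -
  let ?u2 = "mult_mat \<phi> P u *v u"
  have "inner_mat M u (D *v ?u2) + inner_mat M ?u2 (D *v u)
      = (R *v u) $ 2 * (R *v ?u2) $ 2 - (R *v u) $ 1 * (R *v ?u2) $ 1"
    using summation_by_parts[of u ?u2]
    by (simp add: R_def inner_mat_commute[of "D *v u"] inner_boundary_mat)
  then show ?thesis
    unfolding element_weak_form R_def[symmetric]
    by (simp add: inner_boundary_mat power2_eq_square power3_eq_cube field_simps)
qed

lemma norm_mat_square: "(norm_mat M v)\<^sup>2 = inner_mat M v v"
proof -
  have "0 \<le> inner_mat M v v"
    using M_pos[of v] by (cases "v = 0") (auto simp: inner_mat_def)
  then show ?thesis by (simp add: norm_mat_def)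
qed

end

section \<open>Summation over the periodic mesh\<close>

lemma left_neighbour_right_neighbour: "i < N \<Longrightarrow> left_neighbour N (right_neighbour N i) = i"
  by (cases "i + 1 = N") (auto simp: left_neighbour_def right_neighbour_def)

lemma bij_betw_right_neighbour: "bij_betw (right_neighbour N) {..<N} {..<N}"
proof -
  have "inj_on (right_neighbour N) {..<N}"
    by (metis inj_onI left_neighbour_right_neighbour lessThan_iff)
  moreover have "right_neighbour N ` {..<N} \<subseteq> {..<N}"
    by (auto simp: right_neighbour_def)
  ultimately show ?thesis
    by (simp add: bij_betw_def endo_inj_surj)
qed

lemma sum_right_neighbour:
  fixes g :: "nat \<Rightarrow> 'a::comm_monoid_add"
  shows "(\<Sum>i<N. g (right_neighbour N i)) = (\<Sum>i<N. g i)"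
  by (rule sum.reindex_bij_betw[OF bij_betw_right_neighbour])

lemma has_real_derivative_inner_mat:
  assumes "(f has_vector_derivative f') (at t within T)"
    and "(g has_vector_derivative g') (at t within T)"
  shows "((\<lambda>s. inner_mat M (f s) (g s)) has_real_derivative
    inner_mat M (f t) g' + inner_mat M f' (g t)) (at t within T)"
proof -
  have "bounded_bilinear (inner_mat M)"
    unfolding inner_mat_def
    by (intro bounded_bilinear.comp[OF bounded_bilinear_inner] bounded_linear_ident
        matrix_vector_mul_bounded_linear)
  from bounded_bilinear.has_vector_derivative[OF this assms] show ?thesis
    by (simp add: has_real_derivative_iff_has_vector_derivative)
qed

text \<open>
  Testing the equation with the Jacobian factor still in front of the time derivative gives
  directly the weighted terms of the global sums, whatever the element widths are.
\<close>

lemma burgers_solution_tested: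
  assumes "burgers_solution \<phi> P M D fnum N x T u" and "t \<in> T"
  obtains u' where "\<And>i. i < N \<Longrightarrow> (u i has_vector_derivative u' i) (at t within T)"
    and "\<And>i a. i < N \<Longrightarrow> jacobian x i * inner_mat M a (u' i)
      = - inner_mat M a (burgers_element \<phi> P M D (flux_vec \<phi> fnum N (\<lambda>k. u k t) i) (u i t))"
proof -
  let ?F = "\<lambda>i. burgers_element \<phi> P M D (flux_vec \<phi> fnum N (\<lambda>k. u k t) i) (u i t)"
  obtain u' where u': "\<And>i. i < N \<Longrightarrow> (u i has_vector_derivative u' i) (at t within T)"
    and eq: "\<And>i. i < N \<Longrightarrow> jacobian x i *\<^sub>R u' i + ?F i = 0"
    using bspec[OF conjunct2[OF conjunct2[OF assms(1)[unfolded burgers_solution_def]]] assms(2)]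
    by metis
  have "jacobian x i * inner_mat M a (u' i) = - inner_mat M a (?F i)" if "i < N" for i a
  proof -
    have "inner_mat M a (jacobian x i *\<^sub>R u' i + ?F i) = 0"
      by (simp add: eq[OF that] inner_mat_def)
    then show ?thesis
      by (simp add: inner_mat_def matrix_vector_right_distrib matrix_vector_mult_scaleR
          inner_add_right eq_neg_iff_add_eq_0)
  qed
  with u' show thesis by (rule that)
qed

lemma burgers_conservative:
  assumes "sbp_method X Xp \<phi> P M D"
  shows "conservative_across_elements \<phi> M N x (burgers_solution \<phi> P M D fnum N x)"
  unfolding conservative_across_elements_def
proof (intro allI impI ballI)
  fix T u t
  assume sol: "burgers_solution \<phi> P M D fnum N x T u" and t: "t \<in> T"
  interpret sbp_method X Xp \<phi> P M D by fact
  define v where "v = (\<lambda>k. u k t)"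
  define h where "h = interface_flux \<phi> fnum N v"
  obtain u' where u': "\<And>i. i < N \<Longrightarrow> (u i has_vector_derivative u' i) (at t within T)"
    and tested: "\<And>i a. i < N \<Longrightarrow> jacobian x i * inner_mat M a (u' i)
      = - inner_mat M a (burgers_element \<phi> P M D (flux_vec \<phi> fnum N v i) (v i))"
    unfolding v_def using burgers_solution_tested[OF sol t] by blast
  have "jacobian x i * inner_mat M (one_vec \<phi>) (u' i) = h (left_neighbour N i) - h i"
    if "i < N" for i
    unfolding tested[OF that] element_mass_balance by (simp add: flux_vec_def h_def)
  then have "(\<Sum>i<N. jacobian x i * inner_mat M (one_vec \<phi>) (u' i))
      = (\<Sum>i<N. h (left_neighbour N i)) - (\<Sum>i<N. h i)"
    by (simp add: sum_subtractf)
  also have "\<dots> = 0"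
    using sum_right_neighbour[of "\<lambda>i. h (left_neighbour N i)" N]
    by (simp add: left_neighbour_right_neighbour)
  finally have sum0: "(\<Sum>i<N. jacobian x i * inner_mat M (one_vec \<phi>) (u' i)) = 0" .
  have "((\<lambda>s. inner_mat M (one_vec \<phi>) (u i s)) has_real_derivative
      inner_mat M (one_vec \<phi>) (u' i)) (at t within T)" if "i < N" for i
    using has_real_derivative_inner_mat[OF has_vector_derivative_const u'[OF that]]
    by (simp add: inner_mat_def)
  then have "((\<lambda>s. \<Sum>i<N. jacobian x i * inner_mat M (one_vec \<phi>) (u i s)) has_real_derivative
      (\<Sum>i<N. jacobian x i * inner_mat M (one_vec \<phi>) (u' i))) (at t within T)"
    by (intro DERIV_sum DERIV_cmult) auto
  then show "((\<lambda>s. \<Sum>i<N. jacobian x i * inner_mat M (one_vec \<phi>) (u i s))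
      has_real_derivative 0) (at t within T)"
    by (simp only: sum0)
qed

text \<open>
  Each interface collects the right boundary term of one element and the left boundary term of
  its right neighbour. They share the numerical flux, so their sum is the entropy production
  that the flux condition bounds.
\<close>

lemma burgers_stable:
  assumes "sbp_method X Xp \<phi> P M D" and flux: "entropy_stable_flux fnum"
  shows "stable_across_elements M N x (burgers_solution \<phi> P M D fnum N x)"
  unfolding stable_across_elements_def
proof (intro allI impI ballI)
  fix T u t
  assume sol: "burgers_solution \<phi> P M D fnum N x T u" and t: "t \<in> T"
  interpret sbp_method X Xp \<phi> P M D by fact
  define v where "v = (\<lambda>k. u k t)"
  define h where "h = interface_flux \<phi> fnum N v"
  define r l where "r i = (restriction_mat \<phi> *v v i) $ 2"
    and "l i = (restriction_mat \<phi> *v v i) $ 1" for i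
  obtain u' where u': "\<And>i. i < N \<Longrightarrow> (u i has_vector_derivative u' i) (at t within T)"
    and tested: "\<And>i a. i < N \<Longrightarrow> jacobian x i * inner_mat M a (u' i)
      = - inner_mat M a (burgers_element \<phi> P M D (flux_vec \<phi> fnum N v i) (v i))"
    unfolding v_def using burgers_solution_tested[OF sol t] by blast
  have "jacobian x i * inner_mat M (v i) (u' i)
      = (l i * h (left_neighbour N i) - (l i)^3 / 6) - (r i * h i - (r i)^3 / 6)"
    if "i < N" for i
    unfolding tested[OF that] element_energy_balance by (simp add: flux_vec_def h_def r_def l_def)
  then have "(\<Sum>i<N. jacobian x i * inner_mat M (v i) (u' i))
      = (\<Sum>i<N. l i * h (left_neighbour N i) - (l i)^3 / 6) - (\<Sum>i<N. r i * h i - (r i)^3 / 6)"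
    by (simp add: sum_subtractf)
  \<comment> \<open>Left boundary terms are attributed to the element on the other side of the interface.\<close>
  moreover have "(\<Sum>i<N. l i * h (left_neighbour N i) - (l i)^3 / 6)
      = (\<Sum>i<N. l (right_neighbour N i) * h i - (l (right_neighbour N i))^3 / 6)"
    using sum_right_neighbour[of "\<lambda>i. l i * h (left_neighbour N i) - (l i)^3 / 6" N]
    by (simp add: left_neighbour_right_neighbour)
  moreover have "l (right_neighbour N i) * h i - (l (right_neighbour N i))^3 / 6
      - (r i * h i - (r i)^3 / 6) \<le> 0" for i
  proof -
    have "(1/6) * ((r i)^3 - (l (right_neighbour N i))^3)
        - (r i - l (right_neighbour N i)) * h i \<le> 0"
      unfolding h_def interface_flux_def r_def[symmetric] l_def[symmetric]
      using flux by (simp only: entropy_stable_flux_def)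
    moreover have "l (right_neighbour N i) * h i - (l (right_neighbour N i))^3 / 6
        - (r i * h i - (r i)^3 / 6)
      = (1/6) * ((r i)^3 - (l (right_neighbour N i))^3)
        - (r i - l (right_neighbour N i)) * h i"
      by (simp add: field_simps)
    ultimately show ?thesis by (simp only:)
  qed
  ultimately have le: "(\<Sum>i<N. jacobian x i * inner_mat M (v i) (u' i)) \<le> 0"
    by (simp only: sum_subtractf[symmetric]) (rule sum_nonpos)
  have "((\<lambda>s. (norm_mat M (u i s))\<^sup>2) has_real_derivative
      2 * inner_mat M (v i) (u' i)) (at t within T)" if "i < N" for i
    using has_real_derivative_inner_mat[OF u'[OF that] u'[OF that], of M]
    by (simp add: norm_mat_square v_def inner_mat_commute[of "u' i"])
  then have "((\<lambda>s. \<Sum>i<N. jacobian x i * (norm_mat M (u i s))\<^sup>2) has_real_derivative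
      (\<Sum>i<N. jacobian x i * (2 * inner_mat M (v i) (u' i)))) (at t within T)"
    by (intro DERIV_sum DERIV_cmult) auto
  moreover have "(\<Sum>i<N. jacobian x i * (2 * inner_mat M (v i) (u' i))) \<le> 0"
    unfolding mult.left_commute[of _ 2] sum_distrib_left[symmetric] using le by simp
  ultimately show "\<exists>d\<le>0. ((\<lambda>s. \<Sum>i<N. jacobian x i * (norm_mat M (u i s))\<^sup>2)
      has_real_derivative d) (at t within T)"
    by (intro exI conjI)
qed

theorem theorem2:
  fixes X Xp :: "real poly set"
    and \<phi> :: "'n::finite \<Rightarrow> real poly"
    and P :: "real poly \<Rightarrow> real poly"
    and M D :: "real^'n^'n"
    and fnum :: "real \<Rightarrow> real \<Rightarrow> real"
    and N :: nat and x :: "nat \<Rightarrow> real"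
  shows "(sbp_method X Xp \<phi> P M D \<and> entropy_stable_flux fnum \<and> periodic_mesh N x \<longrightarrow>
            conservative_across_elements \<phi> M N x (burgers_solution \<phi> P M D fnum N x) \<and>
            stable_across_elements M N x (burgers_solution \<phi> P M D fnum N x)) \<and>
         entropy_stable_flux econ_flux \<and>
         entropy_stable_flux llf_flux \<and>
         entropy_stable_flux osher_flux"
  by (auto intro: burgers_conservative burgers_stable
      simp: entropy_stable_econ_flux entropy_stable_llf_flux entropy_stable_osher_flux)

end
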